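(* Let $I\subset\mathbb R\setminus\{0\}$ be an open interval, $f:I\to\mathbb R$ smooth with $f'^2<1$ and $f''\neq0$ everywhere on $I$, and let $C_4\neq0$ be a real constant. Put $$\mathfrak m=\frac{2f''\left(f'(f'^2-1)^2-s(2f'^2+1)f''\right)+s(f'^2-1)f'f'''}{s^3(f'^2-1)^4},$$ $$\mathfrak n=-\frac{f''\left(2f'(f'^2-1)+s(3f'^2+2)f''\right)-s(f'^2-1)f'f'''}{C_4s^3(1-f'^2)^{7/2}},$$ and assume that $\mathfrak m$ and $\mathfrak n$ are non-zero functions. Then the rotational hypersurface $\Gamma^s(s,t,w)=(s\cosh t\cosh w,\ s\sinh t,\ s\cosh t\sinh w,\ f(s))$ in $\mathbb E_1^4$ with Gauss map $N^{s}=-\frac{1}{\sqrt{1-f'^2}}(f'\cosh t\cosh w,\ f'\sinh t,\ f'\cosh t\sinh w,\ 1)$ has generalized $L_2$ 1-type Gauss map; namely $L_2N^s=\mathfrak mN^s+\mathfrak nC$ with $C=(0,0,0,C_4)$.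
   Context: $\mathbb E_1^4$ is $\mathbb R^4$ with the Lorentzian metric $\langle\,,\rangle=-dx_1^2+dx_2^2+dx_3^2+dx_4^2$. Let $M$ be an oriented hypersurface of $\mathbb E_1^4$ with nondegenerate induced metric $g$, unit normal vector field (Gauss map) $N$, $\varepsilon=\langle N,N\rangle=\pm1$, shape operator $S=-dN$ and principal curvatures $\kappa_1,\kappa_2,\kappa_3$. Put $a_0=1$, $a_1=-(\kappa_1+\kappa_2+\kappa_3)$, $a_2=\kappa_1\kappa_2+\kappa_1\kappa_3+\kappa_2\kappa_3$, $a_3=-\kappa_1\kappa_2\kappa_3$. The Newton transformations are $P_0=I$, $P_k=a_kI+S\circ P_{k-1}$, and $L_k(\varphi)=\mathrm{tr}(P_k\circ\nabla^2\varphi)$ for $\varphi\in C^\infty(M)$, where $\nabla^2\varphi$ is the Hessian operator of $\varphi$ with respect to $g$; $L_k$ acts componentwise on $\mathbb R^4$-valued functions such as $N$. With $n=3$, $\binom{n}{k}H_k=(-\varepsilon)^ka_k$ and $C_k=\binom{n}{k+1}(-\varepsilon)^k$, the known formula used for the Gauss map is $L_kN=-\varepsilon C_k\big(\nabla H_{k+1}+(nH_1H_{k+1}-(n-k-1)H_{k+2})N\big)$, where $\nabla$ is the gradient of $g$ (for $k=2$ the last term has coefficient $0$). $M$ has generalized $L_k$ 1-type Gauss map if $L_kN=\mathfrak mN+\mathfrak nC$ for non-zero (i.e. not identically zero) smooth functions $\mathfrak m,\mathfrak n$ on $M$ and a non-zero constant vector $C\in\mathbb E_1^4$. Primes denote $d/ds$;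 $s\in I$ and $t,w\in\mathbb R$. *)

theory Defs
  imports "HOL-Analysis.Analysis"
begin

text \<open>Smoothness on an open set: all iterated directional derivatives exist and are continuous.\<close>

primrec Ck_on :: "nat \<Rightarrow> 'a::euclidean_space set \<Rightarrow> ('a \<Rightarrow> 'b::euclidean_space) \<Rightarrow> bool" where
  "Ck_on 0 U F \<longleftrightarrow> continuous_on U F"
| "Ck_on (Suc k) U F \<longleftrightarrow>
     (\<forall>p\<in>U. F differentiable (at p)) \<and>
     (\<forall>v. Ck_on k U (\<lambda>p. frechet_derivative F (at p) v))"

definition smooth_on :: "'a::euclidean_space set \<Rightarrow> ('a \<Rightarrow> 'b::euclidean_space) \<Rightarrow> bool" where
  "smooth_on U F \<longleftrightarrow> (\<forall>k. Ck_on k U F)"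

definition partial :: "3 \<Rightarrow> (real^3 \<Rightarrow> 'b::euclidean_space) \<Rightarrow> real^3 \<Rightarrow> 'b" where
  "partial i F p = frechet_derivative F (at p) (axis i 1)"

definition lorentz :: "real^4 \<Rightarrow> real^4 \<Rightarrow> real" where
  "lorentz x y = - (x$1 * y$1) + x$2 * y$2 + x$3 * y$3 + x$4 * y$4"

text \<open>
  A hypersurface is given by a global parametrization \<open>X\<close> of it on an open subset \<open>U\<close> of
  \<open>\<real>\<^sup>3\<close>. Functions on the hypersurface, among them the Gauss map \<open>N\<close>, are functions of
  the parameters. Tangent vectors are written in the coordinate frame, so operators on tangent
  spaces are \<open>3 \<times> 3\<close> matrices whose entry in row \<open>i\<close>, column \<open>j\<close> is the
  \<open>i\<close>-th coordinate of the image of the \<open>j\<close>-th frame vector.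
\<close>

definition induced_metric :: "(real^3 \<Rightarrow> real^4) \<Rightarrow> real^3 \<Rightarrow> real^3^3" where
  "induced_metric X p = (\<chi> i j. lorentz (partial i X p) (partial j X p))"

text \<open>Nondegeneracy of the metric makes \<open>X\<close> an immersion.\<close>

definition oriented_hypersurface ::
  "(real^3) set \<Rightarrow> (real^3 \<Rightarrow> real^4) \<Rightarrow> (real^3 \<Rightarrow> real^4) \<Rightarrow> bool" where
  "oriented_hypersurface U X N \<longleftrightarrow>
     open U \<and> smooth_on U X \<and> smooth_on U N \<and>
     (\<exists>Y. homeomorphism U (X ` U) X Y) \<and>
     (\<forall>p\<in>U. det (induced_metric X p) \<noteq> 0) \<and>
     (\<forall>p\<in>U. \<forall>i. lorentz (N p) (partial i X p) = 0) \<and>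
     (\<exists>\<epsilon>\<in>{1, -1}. \<forall>p\<in>U. lorentz (N p) (N p) = \<epsilon>)"

text \<open>The matrix \<open>S\<close> with \<open>dN = - dX \<circ> S\<close>.\<close>

definition shape_operator :: "(real^3 \<Rightarrow> real^4) \<Rightarrow> (real^3 \<Rightarrow> real^4) \<Rightarrow> real^3 \<Rightarrow> real^3^3" where
  "shape_operator X N p =
     (THE S. \<forall>v. frechet_derivative N (at p) v = - frechet_derivative X (at p) (S *v v))"

text \<open>
  The eigenvalues with multiplicity, in some order. They are taken in \<open>\<complex>\<close>, because a
  self-adjoint operator of an indefinite metric can have nonreal eigenvalues.
\<close>

definition principal_curvatures :: "real^3^3 \<Rightarrow> complex^3" where
  "principal_curvatures S =
     (SOME \<kappa>. \<forall>x. det (mat x - (\<chi> i j. complex_of_real (S$i$j))) = (\<Prod>i\<in>UNIV. x - \<kappa>$i))"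

text \<open>
  The coefficients \<open>a\<^sub>k\<close>. They are real, since nonreal eigenvalues come in conjugate
  pairs, so \<^const>\<open>Re\<close> only changes the type.
\<close>

definition curv_coeff :: "real^3^3 \<Rightarrow> nat \<Rightarrow> real" where
  "curv_coeff S k = (let \<kappa> = principal_curvatures S in Re (
     if k = 0 then 1
     else if k = 1 then - (\<kappa>$1 + \<kappa>$2 + \<kappa>$3)
     else if k = 2 then \<kappa>$1 * \<kappa>$2 + \<kappa>$1 * \<kappa>$3 + \<kappa>$2 * \<kappa>$3
     else if k = 3 then - (\<kappa>$1 * \<kappa>$2 * \<kappa>$3)
     else 0))"

primrec newton :: "real^3^3 \<Rightarrow> nat \<Rightarrow> real^3^3" where
  "newton S 0 = mat 1"
| "newton S (Suc k) = mat (curv_coeff S (Suc k)) + S ** newton S k"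

definition christoffel :: "(real^3 \<Rightarrow> real^4) \<Rightarrow> 3 \<Rightarrow> 3 \<Rightarrow> 3 \<Rightarrow> real^3 \<Rightarrow> real" where
  "christoffel X i j k p = (\<Sum>l\<in>UNIV. matrix_inv (induced_metric X p) $ i $ l *
     (partial j (\<lambda>q. induced_metric X q $ k $ l) p + partial k (\<lambda>q. induced_metric X q $ j $ l) p
        - partial l (\<lambda>q. induced_metric X q $ j $ k) p) / 2)"

definition grad :: "(real^3 \<Rightarrow> real^4) \<Rightarrow> (real^3 \<Rightarrow> real) \<Rightarrow> real^3 \<Rightarrow> real^3" where
  "grad X \<phi> p = matrix_inv (induced_metric X p) *v (\<chi> i. partial i \<phi> p)"

text \<open>The covariant derivative \<open>v \<mapsto> \<nabla>\<^sub>v grad \<phi>\<close> for the Levi-Civita connection.\<close>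

definition hessian_op :: "(real^3 \<Rightarrow> real^4) \<Rightarrow> (real^3 \<Rightarrow> real) \<Rightarrow> real^3 \<Rightarrow> real^3^3" where
  "hessian_op X \<phi> p = (\<chi> i j. partial j (\<lambda>q. grad X \<phi> q $ i) p
     + (\<Sum>k\<in>UNIV. christoffel X i j k p * grad X \<phi> p $ k))"

definition L_op ::
  "nat \<Rightarrow> (real^3 \<Rightarrow> real^4) \<Rightarrow> (real^3 \<Rightarrow> real^4) \<Rightarrow> (real^3 \<Rightarrow> real) \<Rightarrow> real^3 \<Rightarrow> real" where
  "L_op k X N \<phi> p = trace (newton (shape_operator X N p) k ** hessian_op X \<phi> p)"

definition L_vec ::
  "nat \<Rightarrow> (real^3 \<Rightarrow> real^4) \<Rightarrow> (real^3 \<Rightarrow> real^4) \<Rightarrow> (real^3 \<Rightarrow> real^4) \<Rightarrow> real^3 \<Rightarrow> real^4" where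
  "L_vec k X N F p = (\<chi> i. L_op k X N (\<lambda>q. F q $ i) p)"

definition generalized_1_type_Gauss_map ::
  "nat \<Rightarrow> (real^3) set \<Rightarrow> (real^3 \<Rightarrow> real^4) \<Rightarrow> (real^3 \<Rightarrow> real^4) \<Rightarrow> bool" where
  "generalized_1_type_Gauss_map k U X N \<longleftrightarrow>
     (\<exists>\<mm> \<nn> C. smooth_on U \<mm> \<and> smooth_on U \<nn> \<and>
        (\<exists>p\<in>U. \<mm> p \<noteq> 0) \<and> (\<exists>p\<in>U. \<nn> p \<noteq> 0) \<and> C \<noteq> 0 \<and>
        (\<forall>p\<in>U. L_vec k X N N p = \<mm> p *\<^sub>R N p + \<nn> p *\<^sub>R C))"

text \<open>The rotational hypersurface and its Gauss map, with parameters \<open>(s, t, w)\<close>.\<close>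

definition rot_hypersurface :: "(real \<Rightarrow> real) \<Rightarrow> real^3 \<Rightarrow> real^4" where
  "rot_hypersurface f p = (let s = p$1; t = p$2; w = p$3 in
     vector [s * cosh t * cosh w, s * sinh t, s * cosh t * sinh w, f s])"

definition rot_gauss :: "(real \<Rightarrow> real) \<Rightarrow> real^3 \<Rightarrow> real^4" where
  "rot_gauss f p = (let s = p$1; t = p$2; w = p$3; f' = deriv f s in
     (- 1 / sqrt (1 - f'^2)) *\<^sub>R
       vector [f' * cosh t * cosh w, f' * sinh t, f' * cosh t * sinh w, 1])"

end

theory Submission
  imports Defs
begin

text \<open>
  In the coordinates \<open>(s, t, w)\<close> the induced metric is
  \<open>diag (-(1 - f'\<^sup>2), s\<^sup>2, s\<^sup>2 cosh\<^sup>2 t)\<close> and the shape operator is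
  \<open>diag (f'' / r\<^sup>3, f' / (s r), f' / (s r))\<close> with \<open>r = sqrt (1 - f'\<^sup>2)\<close>. Hence \<open>P\<^sub>2\<close> is
  diagonal and only the diagonal of the Hessian enters \<open>L\<^sub>2\<close>. The components of \<open>N\<close> are
  products \<open>A(s) Y(t, w)\<close> in which \<open>Y\<close> is constant or the restriction of a linear coordinate to
  the hyperbolic plane with metric \<open>dt\<^sup>2 + cosh\<^sup>2 t dw\<^sup>2\<close>, that is, an eigenfunction of its
  Laplacian with eigenvalue \<open>0\<close> or \<open>2\<close>. So \<open>L\<^sub>2\<close> of each component is \<open>Y\<close> times a rational
  expression in \<open>s\<close>, \<open>r\<close> and the derivatives of \<open>f\<close>. It equals \<open>\<mm> A\<close> when the eigenvalue is \<open>2\<close>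
  and \<open>\<mm> A + \<nn> C\<^sub>4\<close> when it is \<open>0\<close>.
\<close>

section \<open>Smooth functions\<close>

lemma Ck_on_cong:
  assumes "open U" "\<And>p. p \<in> U \<Longrightarrow> F p = G p" "Ck_on k U F"
  shows "Ck_on k U G"
  using assms(2,3)
proof (induction k arbitrary: F G)
  case 0
  then show ?case using continuous_on_cong by fastforce
next
  case (Suc k)
  have D: "(F has_derivative frechet_derivative F (at p)) (at p)" if "p \<in> U" for p
    using Suc.prems(2) that by (simp add: frechet_derivative_works)
  have D': "(G has_derivative frechet_derivative F (at p)) (at p)" if "p \<in> U" for p
    using has_derivative_transform_within_open[OF D \<open>open U\<close>] Suc.prems(1) that by blast
  have "Ck_on k U (\<lambda>p. frechet_derivative G (at p) v)" for v
  proof (rule Suc.IH)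
    show "Ck_on k U (\<lambda>p. frechet_derivative F (at p) v)"
      using Suc.prems(2) by simp
    show "frechet_derivative F (at p) v = frechet_derivative G (at p) v" if "p \<in> U" for p
      using frechet_derivative_at[OF D'[OF that]] by simp
  qed
  then show ?case using D' by (auto simp: differentiable_def)
qed

lemma Ck_on_Suc_imp: "Ck_on (Suc k) U F \<Longrightarrow> Ck_on k U F"
proof (induction k arbitrary: F)
  case 0
  then show ?case
    by (simp add: continuous_at_imp_continuous_on differentiable_imp_continuous_within)
next
  case (Suc k)
  then have "Ck_on k U (\<lambda>p. frechet_derivative F (at p) v)" for v
    by (intro Suc.IH) simp
  with Suc.prems show ?case by simp
qed

lemma Ck_on_const: "Ck_on k U (\<lambda>p. c)"
  by (induction k arbitrary: c) auto

lemma Ck_on_linear: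
  assumes "bounded_linear L"
  shows "Ck_on k U L"
proof (cases k)
  case 0
  then show ?thesis using assms by (simp add: linear_continuous_on)
next
  case (Suc n)
  have "L differentiable (at p)" "frechet_derivative L (at p) = L" for p
    using bounded_linear_imp_has_derivative[OF assms, of "at p"] frechet_derivative_at
    unfolding differentiable_def by metis+
  then show ?thesis using Suc by (simp add: Ck_on_const)
qed

lemma Ck_on_SucI:
  assumes "open U"
    and "\<And>p. p \<in> U \<Longrightarrow> (F has_derivative F' p) (at p)"
    and "\<And>v. Ck_on k U (\<lambda>p. F' p v)"
  shows "Ck_on (Suc k) U F"
proof -
  have "F' p = frechet_derivative F (at p)" if "p \<in> U" for p
    using assms(2)[OF that] by (rule frechet_derivative_at)
  then have "Ck_on k U (\<lambda>p. frechet_derivative F (at p) v)" for v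
    by (intro Ck_on_cong[OF assms(1) _ assms(3)]) simp
  then show ?thesis using assms(2) by (auto simp: differentiable_def)
qed

lemma Ck_on_SucD:
  assumes "Ck_on (Suc k) U F"
  shows "p \<in> U \<Longrightarrow> (F has_derivative frechet_derivative F (at p)) (at p)"
    and "Ck_on k U (\<lambda>p. frechet_derivative F (at p) v)"
  using assms by (auto simp: frechet_derivative_works)

lemma Ck_on_add:
  assumes "open U" "Ck_on k U F" "Ck_on k U G"
  shows "Ck_on k U (\<lambda>p. F p + G p)"
  using assms(2,3)
proof (induction k arbitrary: F G)
  case 0
  then show ?case by (simp add: continuous_on_add)
next
  case (Suc k)
  show ?case
    by (rule Ck_on_SucI[OF \<open>open U\<close>
          has_derivative_add[OF Ck_on_SucD(1)[OF Suc.prems(1)] Ck_on_SucD(1)[OF Suc.prems(2)]]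
          Suc.IH[OF Ck_on_SucD(2)[OF Suc.prems(1)] Ck_on_SucD(2)[OF Suc.prems(2)]]])
qed

lemma Ck_on_scaleR:
  fixes f :: "'a::euclidean_space \<Rightarrow> real"
  assumes "open U" "Ck_on k U f" "Ck_on k U F"
  shows "Ck_on k U (\<lambda>p. f p *\<^sub>R F p)"
  using assms(2,3)
proof (induction k arbitrary: f F)
  case 0
  then show ?case by (simp add: continuous_on_scaleR)
next
  case (Suc k)
  show ?case
    by (rule Ck_on_SucI[OF \<open>open U\<close>
          has_derivative_scaleR[OF Ck_on_SucD(1)[OF Suc.prems(1)] Ck_on_SucD(1)[OF Suc.prems(2)]]
          Ck_on_add[OF \<open>open U\<close>
            Suc.IH[OF Ck_on_Suc_imp[OF Suc.prems(1)] Ck_on_SucD(2)[OF Suc.prems(2)]]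
            Suc.IH[OF Ck_on_SucD(2)[OF Suc.prems(1)] Ck_on_Suc_imp[OF Suc.prems(2)]]]])
qed

lemma Ck_on_compose:
  fixes g :: "real \<Rightarrow> real"
  assumes "open U" "F ` U \<subseteq> J" "Ck_on k J g" "Ck_on k U F"
  shows "Ck_on k U (\<lambda>p. g (F p))"
  using assms(3,4)
proof (induction k arbitrary: g)
  case 0
  then show ?case using assms(2) by (auto intro: continuous_on_compose2)
next
  case (Suc k)
  show ?case
  proof (rule Ck_on_SucI[OF \<open>open U\<close>])
    fix p assume "p \<in> U"
    then have g: "(g has_derivative frechet_derivative g (at (F p))) (at (F p))"
      using Suc.prems(1) assms(2) by (intro Ck_on_SucD) auto
    have "frechet_derivative g (at (F p)) = (\<lambda>x. x *\<^sub>R frechet_derivative g (at (F p)) 1)"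
    proof
      show "frechet_derivative g (at (F p)) x = x *\<^sub>R frechet_derivative g (at (F p)) 1" for x
        using linear_scale[OF has_derivative_linear[OF g], of x 1] by simp
    qed
    with g have "(g has_derivative (\<lambda>x. x *\<^sub>R frechet_derivative g (at (F p)) 1)) (at (F p))"
      by (rule back_subst[of "\<lambda>h. (g has_derivative h) (at (F p))"])
    with Ck_on_SucD(1)[OF Suc.prems(2) \<open>p \<in> U\<close>]
    show "((\<lambda>p. g (F p)) has_derivative
        (\<lambda>v. frechet_derivative F (at p) v *\<^sub>R frechet_derivative g (at (F p)) 1)) (at p)"
      using diff_chain_at[of F _ p g] by (simp add: o_def)
  next
    fix v
    show "Ck_on k U (\<lambda>p. frechet_derivative F (at p) v *\<^sub>R frechet_derivative g (at (F p)) 1)"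
      by (rule Ck_on_scaleR[OF \<open>open U\<close> Ck_on_SucD(2)[OF Suc.prems(2)]
            Suc.IH[OF Ck_on_SucD(2)[OF Suc.prems(1)] Ck_on_Suc_imp[OF Suc.prems(2)]]])
  qed
qed

lemma Ck_on_real_SucI:
  fixes g :: "real \<Rightarrow> real"
  assumes "open J" "\<And>s. s \<in> J \<Longrightarrow> (g has_real_derivative g' s) (at s)" "Ck_on k J g'"
  shows "Ck_on (Suc k) J g"
proof (rule Ck_on_SucI[OF assms(1)])
  show "(g has_derivative (\<lambda>v. v *\<^sub>R g' s)) (at s)" if "s \<in> J" for s
    using assms(2)[OF that] by (simp add: has_field_derivative_def mult_commute_abs)
  show "Ck_on k J (\<lambda>s. v *\<^sub>R g' s)" for v
    by (intro Ck_on_scaleR assms Ck_on_const)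
qed

lemma smooth_on_const: "smooth_on U (\<lambda>p. c)"
  by (simp add: smooth_on_def Ck_on_const)

lemma smooth_on_linear: "bounded_linear L \<Longrightarrow> smooth_on U L"
  by (simp add: smooth_on_def Ck_on_linear)

lemma smooth_on_ident: "smooth_on U (\<lambda>p. p)"
  by (rule smooth_on_linear[OF bounded_linear_ident])

lemma smooth_on_nth: "smooth_on U (\<lambda>p::real^'n. p $ i)"
  by (rule smooth_on_linear[OF bounded_linear_vec_nth])

lemma smooth_on_cong:
  "open U \<Longrightarrow> smooth_on U F \<Longrightarrow> (\<And>p. p \<in> U \<Longrightarrow> F p = G p) \<Longrightarrow> smooth_on U G"
  by (metis smooth_on_def Ck_on_cong)

lemma smooth_on_add:
  "open U \<Longrightarrow> smooth_on U F \<Longrightarrow> smooth_on U G \<Longrightarrow> smooth_on U (\<lambda>p. F p + G p)"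
  by (simp add: smooth_on_def Ck_on_add)

lemma smooth_on_scaleR:
  fixes f :: "'a::euclidean_space \<Rightarrow> real"
  shows "open U \<Longrightarrow> smooth_on U f \<Longrightarrow> smooth_on U F \<Longrightarrow> smooth_on U (\<lambda>p. f p *\<^sub>R F p)"
  by (simp add: smooth_on_def Ck_on_scaleR)

lemma smooth_on_mult:
  fixes f g :: "'a::euclidean_space \<Rightarrow> real"
  shows "open U \<Longrightarrow> smooth_on U f \<Longrightarrow> smooth_on U g \<Longrightarrow> smooth_on U (\<lambda>p. f p * g p)"
  using smooth_on_scaleR[of U f g] by simp

lemma smooth_on_minus:
  "open U \<Longrightarrow> smooth_on U F \<Longrightarrow> smooth_on U (\<lambda>p. - F p)"
  using smooth_on_scaleR[of U "\<lambda>p. -1" F] by (simp add: smooth_on_const)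

lemma smooth_on_diff:
  "open U \<Longrightarrow> smooth_on U F \<Longrightarrow> smooth_on U G \<Longrightarrow> smooth_on U (\<lambda>p. F p - G p)"
  using smooth_on_add[of U F "\<lambda>p. - G p"] by (simp add: smooth_on_minus)

lemma smooth_on_power:
  fixes f :: "'a::euclidean_space \<Rightarrow> real"
  shows "open U \<Longrightarrow> smooth_on U f \<Longrightarrow> smooth_on U (\<lambda>p. f p ^ n)"
  by (induction n) (simp_all add: smooth_on_const smooth_on_mult)

lemma smooth_on_compose:
  fixes g :: "real \<Rightarrow> real"
  shows "open U \<Longrightarrow> smooth_on J g \<Longrightarrow> smooth_on U F \<Longrightarrow> F ` U \<subseteq> J \<Longrightarrow> smooth_on U (\<lambda>p. g (F p))"
  by (simp add: smooth_on_def Ck_on_compose)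

lemma Ck_on_powr: "Ck_on k {0<..} (\<lambda>x::real. x powr a)"
proof (induction k arbitrary: a)
  case 0
  show ?case by (auto intro!: continuous_intros)
next
  case (Suc k)
  show ?case
  proof (rule Ck_on_real_SucI)
    show "((\<lambda>x. x powr a) has_real_derivative a * s powr (a - 1)) (at s)" if "s \<in> {0<..}" for s
      using that has_real_derivative_powr by auto
    show "Ck_on k {0<..} (\<lambda>x. a * x powr (a - 1))"
      using Ck_on_scaleR[OF _ Ck_on_const Suc.IH, of a "a - 1"] by simp
  qed simp
qed

lemma smooth_on_powr:
  fixes f :: "'a::euclidean_space \<Rightarrow> real"
  assumes "open U" "smooth_on U f" "\<And>p. p \<in> U \<Longrightarrow> f p > 0"
  shows "smooth_on U (\<lambda>p. f p powr a)"
  by (rule smooth_on_compose[of _ "{0<..}"]) (use assms in \<open>auto simp: smooth_on_def Ck_on_powr\<close>)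

lemma smooth_on_divide:
  fixes f g :: "'a::euclidean_space \<Rightarrow> real"
  assumes "open U" "smooth_on U f" "smooth_on U g" "\<And>p. p \<in> U \<Longrightarrow> g p \<noteq> 0"
  shows "smooth_on U (\<lambda>p. f p / g p)"
proof (rule smooth_on_cong[OF assms(1)])
  show "smooth_on U (\<lambda>p. f p * (g p * ((g p)\<^sup>2) powr (-1)))"
    using assms by (intro smooth_on_mult smooth_on_powr smooth_on_power) auto
  show "f p * (g p * ((g p)\<^sup>2) powr (-1)) = f p / g p" if "p \<in> U" for p
    using assms(4)[OF that] by (simp add: powr_minus_divide power2_eq_square)
qed

lemma smooth_on_sinh: "smooth_on UNIV (sinh :: real \<Rightarrow> real)"
  and smooth_on_cosh: "smooth_on UNIV (cosh :: real \<Rightarrow> real)"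
proof -
  have "Ck_on k UNIV (sinh :: real \<Rightarrow> real) \<and> Ck_on k UNIV (cosh :: real \<Rightarrow> real)" for k
  proof (induction k)
    case 0
    show ?case by (auto intro!: continuous_intros)
  next
    case (Suc k)
    then show ?case
      by (intro conjI Ck_on_real_SucI[of _ sinh cosh] Ck_on_real_SucI[of _ cosh sinh])
        (auto intro!: derivative_eq_intros)
  qed
  then show "smooth_on UNIV (sinh :: real \<Rightarrow> real)" "smooth_on UNIV (cosh :: real \<Rightarrow> real)"
    by (auto simp: smooth_on_def)
qed

lemma smooth_on_real_derivD:
  fixes g :: "real \<Rightarrow> real"
  assumes "open J" "smooth_on J g"
  shows "s \<in> J \<Longrightarrow> (g has_real_derivative deriv g s) (at s)" and "smooth_on J (deriv g)"
proof -
  have D: "(g has_real_derivative deriv g s) (at s)" if "s \<in> J" for s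
  proof -
    have "Ck_on (Suc 0) J g"
      using assms(2) unfolding smooth_on_def by blast
    then have "g differentiable (at s)"
      using that by simp
    then show ?thesis
      by (simp add: DERIV_deriv_iff_real_differentiable)
  qed
  then show "s \<in> J \<Longrightarrow> (g has_real_derivative deriv g s) (at s)" .
  show "smooth_on J (deriv g)"
    unfolding smooth_on_def
  proof
    fix k
    have "frechet_derivative g (at s) 1 = deriv g s" if "s \<in> J" for s
      using frechet_derivative_at[OF D[OF that, unfolded has_field_derivative_def], symmetric] by simp
    moreover have "Ck_on k J (\<lambda>s. frechet_derivative g (at s) 1)"
      using assms(2) by (intro Ck_on_SucD(2)) (simp only: smooth_on_def)
    ultimately show "Ck_on k J (deriv g)"
      by (rule Ck_on_cong[OF assms(1)])
  qed
qed

lemma smooth_on_vec: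
  fixes F :: "'a::euclidean_space \<Rightarrow> real^'n"
  assumes "open U" "\<And>i. smooth_on U (\<lambda>p. F p $ i)"
  shows "smooth_on U F"
proof -
  have *: "smooth_on U (\<lambda>p. \<Sum>i\<in>A. F p $ i *\<^sub>R (axis i 1 :: real^'n))" if "finite A" for A
    using that
  proof induction
    case empty
    show ?case by (simp add: smooth_on_const)
  next
    case (insert i A)
    then show ?case
      using smooth_on_add[OF assms(1) smooth_on_scaleR[OF assms smooth_on_const] insert.IH]
      by simp
  qed
  moreover have "(\<Sum>i\<in>UNIV. F p $ i *\<^sub>R (axis i 1 :: real^'n)) = F p" for p
    using basis_expansion[of "F p"] by (simp only: scalar_mult_eq_scaleR)
  ultimately show ?thesis
    using *[of UNIV] by simp
qed

lemma smooth_differentiable: "smooth_on U F \<Longrightarrow> p \<in> U \<Longrightarrow> F differentiable (at p)"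
  unfolding smooth_on_def by (drule spec[of _ "Suc 0"]) simp

section \<open>Hypersurfaces with an orthogonal principal frame\<close>

lemma partial_eqI: "(F has_derivative F') (at p) \<Longrightarrow> partial i F p = F' (axis i 1)"
  using frechet_derivative_at unfolding partial_def by metis

lemma partial_cong:
  assumes "open U" "p \<in> U" "\<And>q. q \<in> U \<Longrightarrow> F q = G q"
  shows "partial i F p = partial i G p"
proof -
  have "(F has_derivative D) (at p) \<longleftrightarrow> (G has_derivative D) (at p)" for D
    using assms has_derivative_transform_within_open[of F D p UNIV U G]
      has_derivative_transform_within_open[of G D p UNIV U F] by auto
  then show ?thesis by (simp add: partial_def frechet_derivative_def)
qed

lemma partial_nth:
  assumes "F differentiable (at p)"
  shows "partial i F p $ c = partial i (\<lambda>q. F q $ c) p"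
proof -
  have "((\<lambda>q. F q $ c) has_derivative (\<lambda>v. frechet_derivative F (at p) v $ c)) (at p)"
    using assms bounded_linear.has_derivative[OF bounded_linear_vec_nth]
    by (simp add: frechet_derivative_works)
  then show ?thesis by (simp add: partial_eqI) (simp add: partial_def)
qed

lemma frechet_derivative_eq_sum_partial:
  assumes "F differentiable (at p)"
  shows "frechet_derivative F (at p) v = (\<Sum>i\<in>UNIV. v $ i *\<^sub>R partial i F p)"
proof -
  have lin: "linear (frechet_derivative F (at p))"
    using assms by (rule linear_frechet_derivative)
  have "(\<Sum>i\<in>UNIV. v $ i *\<^sub>R (axis i 1 :: real^3)) = v"
    using basis_expansion[of v] by (simp only: scalar_mult_eq_scaleR)
  then have "frechet_derivative F (at p) v
      = frechet_derivative F (at p) (\<Sum>i\<in>UNIV. v $ i *\<^sub>R (axis i 1 :: real^3))"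
    by simp
  also have "\<dots> = (\<Sum>i\<in>UNIV. v $ i *\<^sub>R partial i F p)"
    by (simp add: linear_sum[OF lin] linear_scale[OF lin] partial_def)
  finally show ?thesis .
qed

definition diag_mat :: "('n \<Rightarrow> 'a::zero) \<Rightarrow> 'a^'n^'n" where
  "diag_mat d = (\<chi> i j. if i = j then d i else 0)"

lemma det_diag_mat: "det (diag_mat d) = (\<Prod>i\<in>UNIV. d i)"
  by (subst det_diagonal) (auto simp: diag_mat_def)

lemma diag_mat_mult_vec: "diag_mat d *v v = (\<chi> i. d i * v $ i)"
  for d :: "'n::finite \<Rightarrow> 'a::semiring_1"
  by (simp add: diag_mat_def matrix_vector_mult_def vec_eq_iff if_distrib if_distribR cong: if_cong)

lemma diag_mat_mult: "diag_mat d ** A = (\<chi> i j. d i * A $ i $ j)"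
  for d :: "'n::finite \<Rightarrow> 'a::semiring_1"
  by (simp add: diag_mat_def matrix_matrix_mult_def vec_eq_iff if_distrib if_distribR cong: if_cong)

lemma matrix_inv_diag_mat:
  fixes d :: "'n::finite \<Rightarrow> real"
  assumes "\<And>i. d i \<noteq> 0"
  shows "matrix_inv (diag_mat d) = diag_mat (\<lambda>i. 1 / d i)"
proof -
  let ?B = "diag_mat (\<lambda>i. 1 / d i)"
  have B: "diag_mat d ** ?B = mat 1" "?B ** diag_mat d = mat 1"
    unfolding diag_mat_mult using assms by (auto simp: diag_mat_def mat_def vec_eq_iff)
  then have "matrix_inv (diag_mat d) ** diag_mat d = mat 1"
    unfolding matrix_inv_def by (metis (mono_tags, lifting) someI_ex)
  then have "matrix_inv (diag_mat d) = matrix_inv (diag_mat d) ** (diag_mat d ** ?B)"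
    using B by (simp only: matrix_mul_rid)
  also have "\<dots> = ?B"
    using \<open>matrix_inv (diag_mat d) ** diag_mat d = mat 1\<close>
    by (simp only: matrix_mul_assoc matrix_mul_lid)
  finally show ?thesis .
qed

lemma lorentz_linear: "linear (lorentz x)"
  by (rule linearI) (auto simp: lorentz_def algebra_simps)

lemma orthogonal_frame_injective:
  assumes "X differentiable (at p)" "induced_metric X p = diag_mat d" "\<And>i. d i \<noteq> 0"
    and "frechet_derivative X (at p) v = 0"
  shows "v = 0"
proof -
  have "v $ j = 0" for j
  proof -
    have "lorentz (partial j X p) (\<Sum>i\<in>UNIV. v $ i *\<^sub>R partial i X p) = 0"
      using assms(1,4) linear_0[OF lorentz_linear] by (simp add: frechet_derivative_eq_sum_partial)
    then have "(\<Sum>i\<in>UNIV. v $ i * lorentz (partial j X p) (partial i X p)) = 0"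
      by (simp add: linear_sum[OF lorentz_linear] linear_scale[OF lorentz_linear])
    moreover have "lorentz (partial j X p) (partial i X p) = (if j = i then d j else 0)" for i
      using arg_cong[OF assms(2), of "\<lambda>A. A $ j $ i"] by (simp add: induced_metric_def diag_mat_def)
    ultimately show ?thesis using assms(3)[of j] by (simp add: if_distrib cong: if_cong)
  qed
  then show ?thesis by (simp add: vec_eq_iff)
qed

lemma shape_operator_diag:
  assumes "X differentiable (at p)" "N differentiable (at p)"
    and "induced_metric X p = diag_mat d" "\<And>i. d i \<noteq> 0"
    and "\<And>i. partial i N p = - (\<kappa> i *\<^sub>R partial i X p)"
  shows "shape_operator X N p = diag_mat \<kappa>"
  unfolding shape_operator_def
proof (rule the_equality)
  show eq: "\<forall>v. frechet_derivative N (at p) v = - frechet_derivative X (at p) (diag_mat \<kappa> *v v)"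
    using assms(1,2,5)
    by (simp add: frechet_derivative_eq_sum_partial diag_mat_mult_vec sum_negf[symmetric] mult.commute)
  fix S assume S: "\<forall>v. frechet_derivative N (at p) v = - frechet_derivative X (at p) (S *v v)"
  have "S *v v = diag_mat \<kappa> *v v" for v
  proof -
    have "frechet_derivative X (at p) (S *v v - diag_mat \<kappa> *v v) = 0"
      using S[rule_format, of v] eq[rule_format, of v]
      by (simp add: linear_diff[OF linear_frechet_derivative[OF assms(1)]])
    then have "S *v v - diag_mat \<kappa> *v v = 0"
      by (rule orthogonal_frame_injective[OF assms(1,3,4)])
    then show ?thesis by simp
  qed
  then show "S = diag_mat \<kappa>" by (simp add: matrix_eq)
qed

lemma grad_diag:
  assumes "induced_metric X p = diag_mat d" "\<And>i. d i \<noteq> 0"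
  shows "grad X \<phi> p = (\<chi> i. partial i \<phi> p / d i)"
  unfolding grad_def assms(1) matrix_inv_diag_mat[OF assms(2)] diag_mat_mult_vec by simp

lemma christoffel_diag:
  assumes "open U" "p \<in> U" "\<And>q. q \<in> U \<Longrightarrow> induced_metric X q = diag_mat (\<lambda>i. G i q)"
    and "\<And>i. G i p \<noteq> 0"
  shows "christoffel X i i k p = partial k (G i) p / (2 * G i p)"
proof -
  have part: "partial j (\<lambda>q. induced_metric X q $ k $ l) p = partial j (\<lambda>q. if k = l then G k q else 0) p"
    for j k l
    using assms(1-3) by (intro partial_cong[of U]) (auto simp: diag_mat_def)
  have "partial j (\<lambda>q. 0) p = (0::real)" for j
    by (rule partial_eqI) simp
  then show ?thesis
    unfolding christoffel_def part assms(3)[OF assms(2)] matrix_inv_diag_mat[OF assms(4)]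
    by (simp add: diag_mat_def if_distrib if_distribR cong: if_cong)
      (cases "k = i"; simp)
qed

lemma hessian_op_diag:
  assumes "open U" "p \<in> U" "\<And>q. q \<in> U \<Longrightarrow> induced_metric X q = diag_mat (\<lambda>i. G i q)"
    and "\<And>q i. q \<in> U \<Longrightarrow> G i q \<noteq> 0"
  shows "hessian_op X \<phi> p $ i $ i = partial i (\<lambda>q. partial i \<phi> q / G i q) p
    + (\<Sum>k\<in>UNIV. partial k (G i) p / (2 * G i p) * (partial k \<phi> p / G k p))"
proof -
  have "partial i (\<lambda>q. grad X \<phi> q $ i) p = partial i (\<lambda>q. partial i \<phi> q / G i q) p"
    using assms by (intro partial_cong[of U]) (simp_all add: grad_diag)
  then show ?thesis
    using assms by (simp add: hessian_op_def christoffel_diag[of U] grad_diag)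
qed

lemma elementary_symmetric_unique:
  fixes a b c a' b' c' :: complex
  assumes "\<And>x. (x - a) * (x - b) * (x - c) = (x - a') * (x - b') * (x - c')"
  shows "a + b + c = a' + b' + c'" "a * b + a * c + b * c = a' * b' + a' * c' + b' * c'"
proof -
  have lin: "s = s' \<and> p = p'" if "t = t'" "1 - s + p - t = 1 - s' + p' - t'" "-1 - s - p - t = -1 - s' - p' - t'"
    for s s' p p' t t' :: complex
    using that by (auto simp: complex_eq_iff)
  have expand: "(x - u) * (x - v) * (x - w)
      = x * x * x - x * x * (u + v + w) + x * (u * v + u * w + v * w) - u * v * w" for x u v w :: complex
    by (simp add: algebra_simps)
  have eq: "x * x * x - x * x * (a + b + c) + x * (a * b + a * c + b * c) - a * b * c
      = x * x * x - x * x * (a' + b' + c') + x * (a' * b' + a' * c' + b' * c') - a' * b' * c'" for x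
    using assms[of x] unfolding expand .
  have "a + b + c = a' + b' + c' \<and> a * b + a * c + b * c = a' * b' + a' * c' + b' * c'"
  proof (rule lin)
    show *: "a * b * c = a' * b' * c'"
      using assms[of 0] by simp
    show "1 - (a + b + c) + (a * b + a * c + b * c) - a * b * c
        = 1 - (a' + b' + c') + (a' * b' + a' * c' + b' * c') - a' * b' * c'"
      using eq[of 1] by (simp only: mult_1_left)
    show "-1 - (a + b + c) - (a * b + a * c + b * c) - a * b * c
        = -1 - (a' + b' + c') - (a' * b' + a' * c' + b' * c') - a' * b' * c'"
      using eq[of "-1"] by simp
  qed
  then show "a + b + c = a' + b' + c'" "a * b + a * c + b * c = a' * b' + a' * c' + b' * c'"
    by blast+
qed

lemma principal_curvatures_diag:
  fixes \<kappa> :: "3 \<Rightarrow> real"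
  defines "k \<equiv> principal_curvatures (diag_mat \<kappa>)"
  shows "(x - k $ 1) * (x - k $ 2) * (x - k $ 3)
    = (x - complex_of_real (\<kappa> 1)) * (x - complex_of_real (\<kappa> 2)) * (x - complex_of_real (\<kappa> 3))"
proof -
  have det: "det (mat x - (\<chi> i j. complex_of_real (diag_mat \<kappa> $ i $ j)))
    = (\<Prod>i\<in>UNIV. x - complex_of_real (\<kappa> i))" for x
    by (subst det_diagonal) (auto simp: diag_mat_def mat_def)
  define P where "P = (\<lambda>k::complex^3. \<forall>x. det (mat x - (\<chi> i j. complex_of_real (diag_mat \<kappa> $ i $ j)))
    = (\<Prod>i\<in>UNIV. x - k $ i))"
  have "P (\<chi> i. complex_of_real (\<kappa> i))"
    by (simp add: P_def det)
  then have "P k"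
    unfolding k_def principal_curvatures_def P_def[symmetric] by (rule someI)
  then have "(\<Prod>i\<in>UNIV. x - k $ i) = (\<Prod>i\<in>UNIV. x - complex_of_real (\<kappa> i))"
    by (simp only: P_def det)
  then show ?thesis
    unfolding UNIV_3 by (simp add: mult.assoc)
qed

lemma curv_coeff_diag:
  fixes \<kappa> :: "3 \<Rightarrow> real"
  shows "curv_coeff (diag_mat \<kappa>) 1 = - (\<kappa> 1 + \<kappa> 2 + \<kappa> 3)"
    and "curv_coeff (diag_mat \<kappa>) 2 = \<kappa> 1 * \<kappa> 2 + \<kappa> 1 * \<kappa> 3 + \<kappa> 2 * \<kappa> 3"
  unfolding curv_coeff_def Let_def
    elementary_symmetric_unique[OF principal_curvatures_diag[of _ \<kappa>]]
  by simp_all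

lemma trace_newton_2_diag:
  fixes \<kappa> :: "3 \<Rightarrow> real"
  shows "trace (newton (diag_mat \<kappa>) 2 ** H)
    = \<kappa> 2 * \<kappa> 3 * H $ 1 $ 1 + \<kappa> 1 * \<kappa> 3 * H $ 2 $ 2 + \<kappa> 1 * \<kappa> 2 * H $ 3 $ 3"
proof -
  have mat: "mat c = (diag_mat (\<lambda>i. c) :: real^3^3)" for c
    by (simp add: mat_def diag_mat_def)
  have add: "diag_mat a + diag_mat b = (diag_mat (\<lambda>i. a i + b i) :: real^3^3)" for a b
    by (simp add: vec_eq_iff diag_mat_def)
  have mul: "diag_mat a ** diag_mat b = (diag_mat (\<lambda>i. a i * b i) :: real^3^3)" for a b
    by (simp add: vec_eq_iff diag_mat_mult) (simp add: diag_mat_def)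
  have "newton (diag_mat \<kappa>) (Suc (Suc 0))
      = diag_mat (\<lambda>i. curv_coeff (diag_mat \<kappa>) 2 + \<kappa> i * (curv_coeff (diag_mat \<kappa>) 1 + \<kappa> i))"
    by (simp add: mat add mul numeral_2_eq_2)
  then show ?thesis
    by (simp add: numeral_2_eq_2[symmetric] curv_coeff_diag diag_mat_mult trace_def sum_3
        del: One_nat_def) (simp add: algebra_simps)
qed

lemma has_derivative_separated:
  fixes A B C :: "real \<Rightarrow> real" and p :: "real^3"
  assumes "(A has_real_derivative a) (at (p$1))" "(B has_real_derivative b) (at (p$2))"
    and "(C has_real_derivative c) (at (p$3))"
  shows "((\<lambda>q. A (q$1) * B (q$2) * C (q$3)) has_derivative
    (\<lambda>v. v$1 * (a * B (p$2) * C (p$3)) + v$2 * (A (p$1) * b * C (p$3))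
       + v$3 * (A (p$1) * B (p$2) * c))) (at p)"
proof -
  have nth: "((\<lambda>q. q $ i) has_derivative (\<lambda>v. v $ i)) (at p)" for i
    by (rule bounded_linear_imp_has_derivative[OF bounded_linear_vec_nth])
  show ?thesis
    by (rule has_derivative_eq_rhs[OF has_derivative_mult[OF has_derivative_mult
            [OF DERIV_compose_FDERIV[OF assms(1) nth] DERIV_compose_FDERIV[OF assms(2) nth]]
            DERIV_compose_FDERIV[OF assms(3) nth]]])
      (auto simp: algebra_simps)
qed

lemma partial_separated:
  fixes A B C :: "real \<Rightarrow> real" and p :: "real^3"
  assumes "open U" "p \<in> U" "\<And>q. q \<in> U \<Longrightarrow> \<phi> q = A (q$1) * B (q$2) * C (q$3)"
    and "(A has_real_derivative a) (at (p$1))" "(B has_real_derivative b) (at (p$2))"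
    and "(C has_real_derivative c) (at (p$3))"
  shows "partial 1 \<phi> p = a * B (p$2) * C (p$3)"
    and "partial 2 \<phi> p = A (p$1) * b * C (p$3)"
    and "partial 3 \<phi> p = A (p$1) * B (p$2) * c"
proof -
  have "partial i \<phi> p = axis i 1$1 * (a * B (p$2) * C (p$3)) + axis i 1$2 * (A (p$1) * b * C (p$3))
       + axis i 1$3 * (A (p$1) * B (p$2) * c)" for i
    by (rule trans[OF partial_cong[OF assms(1-3)] partial_eqI[OF has_derivative_separated[OF assms(4-6)]]])
  then show "partial 1 \<phi> p = a * B (p$2) * C (p$3)"
    and "partial 2 \<phi> p = A (p$1) * b * C (p$3)"
    and "partial 3 \<phi> p = A (p$1) * B (p$2) * c"
    by (simp_all add: axis_def)
qed

lemma vector_4: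
  "(vector [a, b, c, d] :: 'a::zero^4) $ 1 = a" "(vector [a, b, c, d] :: 'a::zero^4) $ 2 = b"
  "(vector [a, b, c, d] :: 'a::zero^4) $ 3 = c" "(vector [a, b, c, d] :: 'a::zero^4) $ 4 = d"
  by (simp_all add: vector_def)

lemma rot_hypersurface_nth:
  "rot_hypersurface f p $ 1 = p$1 * cosh (p$2) * cosh (p$3)"
  "rot_hypersurface f p $ 2 = p$1 * sinh (p$2)"
  "rot_hypersurface f p $ 3 = p$1 * cosh (p$2) * sinh (p$3)"
  "rot_hypersurface f p $ 4 = f (p$1)"
  by (simp_all add: rot_hypersurface_def Let_def vector_4)

lemma lorentz_vector:
  "lorentz (vector [a, b, c, d]) (vector [a', b', c', d']) = - (a * a') + b * b' + c * c' + d * d'"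
  by (simp add: lorentz_def vector_4)

text \<open>Here \<open>a\<close>, \<open>b\<close>, \<open>c\<close>, \<open>\<rho>\<close> stand for the values of \<open>f'\<close>, \<open>f''\<close>, \<open>f'''\<close>, \<open>r\<close> at \<open>s\<close>.\<close>

lemma L2_profile_first:
  fixes a b c s \<rho> :: real
  assumes "s \<noteq> 0" "\<rho> \<noteq> 0"
  shows "a\<^sup>2 / (s\<^sup>2 * \<rho>\<^sup>2) * ((c / \<rho> ^ 5 + 5 * a * b\<^sup>2 / \<rho> ^ 7) - a * b * (b / \<rho> ^ 5) / \<rho>\<^sup>2)
      + a * b / (s * \<rho> ^ 4) * (2 * (b / \<rho> ^ 5) / s + 2 * - (a / \<rho>) / s\<^sup>2)
    = (2 * b * (a * \<rho> ^ 4 - s * (2 * a\<^sup>2 + 1) * b) - s * \<rho>\<^sup>2 * a * c) / (s ^ 3 * \<rho> ^ 8) * - (a / \<rho>)"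
  using assms by (simp add: field_simps) (simp add: algebra_simps power_numeral_reduce)

lemma L2_profile_last:
  fixes a b c s \<rho> :: real
  assumes "s \<noteq> 0" "\<rho> \<noteq> 0" "\<rho>\<^sup>2 = 1 - a\<^sup>2"
  shows "a\<^sup>2 / (s\<^sup>2 * \<rho>\<^sup>2) * ((b\<^sup>2 / \<rho> ^ 5 + a * c / \<rho> ^ 5 + 5 * a\<^sup>2 * b\<^sup>2 / \<rho> ^ 7)
        - a * b * (a * b / \<rho> ^ 5) / \<rho>\<^sup>2)
      + a * b / (s * \<rho> ^ 4) * (2 * (a * b / \<rho> ^ 5) / s)
    = (2 * b * (a * \<rho> ^ 4 - s * (2 * a\<^sup>2 + 1) * b) - s * \<rho>\<^sup>2 * a * c) / (s ^ 3 * \<rho> ^ 8) * - (1 / \<rho>)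
      - (b * (- (2 * a * \<rho>\<^sup>2) + s * (3 * a\<^sup>2 + 2) * b) + s * \<rho>\<^sup>2 * a * c) / (s ^ 3 * \<rho> ^ 7)"
    (is "?L = ?R")
proof -
  have "?L = (s * a\<^sup>2 * (b\<^sup>2 * \<rho>\<^sup>2 + a * c * \<rho>\<^sup>2 + 4 * a\<^sup>2 * b\<^sup>2) + 2 * s * a\<^sup>2 * b\<^sup>2) / (s ^ 3 * \<rho> ^ 9)"
    using assms(1,2) by (simp add: divide_simps) (simp add: algebra_simps power_numeral_reduce)
  also have "s * a\<^sup>2 * (b\<^sup>2 * \<rho>\<^sup>2 + a * c * \<rho>\<^sup>2 + 4 * a\<^sup>2 * b\<^sup>2) + 2 * s * a\<^sup>2 * b\<^sup>2
    = - (2 * b * (a * \<rho> ^ 4 - s * (2 * a\<^sup>2 + 1) * b) - s * \<rho>\<^sup>2 * a * c)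
      - \<rho>\<^sup>2 * (b * (- (2 * a * \<rho>\<^sup>2) + s * (3 * a\<^sup>2 + 2) * b) + s * \<rho>\<^sup>2 * a * c)"
  proof -
    have "\<rho> ^ 4 = (1 - a\<^sup>2)\<^sup>2"
      by (simp flip: power_mult assms(3))
    then show ?thesis unfolding assms(3) by algebra
  qed
  also have "(- P - \<rho>\<^sup>2 * Q) / (s ^ 3 * \<rho> ^ 9) = P / (s ^ 3 * \<rho> ^ 8) * - (1 / \<rho>) - Q / (s ^ 3 * \<rho> ^ 7)"
    for P Q
    using assms(1,2) by (simp add: divide_simps) (simp add: algebra_simps power_numeral_reduce)
  finally show ?thesis .
qed

lemma interval_sign:
  fixes I :: "real set"
  assumes "is_interval I" "0 \<notin> I"
  obtains \<sigma> where "\<sigma> \<in> {1, -1}" "\<And>s. s \<in> I \<Longrightarrow> \<sigma> * s > 0"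
proof (cases "\<exists>s\<in>I. s > 0")
  case True
  then have "s > 0" if "s \<in> I" for s
    using assms that by (metis is_interval_1 less_eq_real_def linorder_not_less)
  then show ?thesis using that[of 1] by simp
next
  case False
  then have "s < 0" if "s \<in> I" for s
    using assms(2) that by (metis linorder_neqE_linordered_idom)
  then show ?thesis using that[of "-1"] by simp
qed

section \<open>The rotational hypersurface\<close>

locale rot_profile =
  fixes I :: "real set" and f :: "real \<Rightarrow> real"
  assumes open_I: "open I" and zero_notin_I: "0 \<notin> I"
    and smooth_f: "smooth_on I f"
    and deriv_less_1: "\<And>s. s \<in> I \<Longrightarrow> (deriv f s)\<^sup>2 < 1"
begin

abbreviation "f1 \<equiv> deriv f"
abbreviation "f2 \<equiv> deriv f1"
abbreviation "f3 \<equiv> deriv f2"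
abbreviation "X \<equiv> rot_hypersurface f"
abbreviation "N \<equiv> rot_gauss f"

definition params :: "(real^3) set" where "params = {p. p$1 \<in> I}"

definition r :: "real \<Rightarrow> real" where "r s = sqrt (1 - (f1 s)\<^sup>2)"

definition G :: "3 \<Rightarrow> real^3 \<Rightarrow> real" where
  "G i p = (if i = 1 then - (r (p$1))\<^sup>2 else if i = 2 then (p$1)\<^sup>2 else (p$1)\<^sup>2 * (cosh (p$2))\<^sup>2)"

definition \<kappa> :: "real^3 \<Rightarrow> 3 \<Rightarrow> real" where
  "\<kappa> p i = (if i = 1 then f2 (p$1) / r (p$1) ^ 3 else f1 (p$1) / (p$1 * r (p$1)))"

lemma open_params: "open params"
proof -
  have "params = (\<lambda>p. p$1) -` I" by (auto simp: params_def)
  then show ?thesis by (simp add: open_vimage[OF open_I] continuous_intros)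
qed

lemma params_nth: "p \<in> params \<Longrightarrow> p$1 \<in> I"
  by (simp add: params_def)

lemma smooth_derivs: "smooth_on I f1" "smooth_on I f2" "smooth_on I f3"
  using smooth_on_real_derivD(2)[OF open_I] smooth_f by blast+

lemma has_derivs:
  assumes "s \<in> I"
  shows "(f has_real_derivative f1 s) (at s)" "(f1 has_real_derivative f2 s) (at s)"
    "(f2 has_real_derivative f3 s) (at s)"
  using smooth_on_real_derivD(1)[OF open_I _ assms] smooth_f smooth_derivs by auto

lemma r_pos: "s \<in> I \<Longrightarrow> r s > 0"
  and r_square: "s \<in> I \<Longrightarrow> (r s)\<^sup>2 = 1 - (f1 s)\<^sup>2"
  using deriv_less_1[of s] by (auto simp: r_def)

lemma nonzero: "s \<in> I \<Longrightarrow> s \<noteq> 0"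
  using zero_notin_I by auto

lemma has_derivative_r:
  assumes "s \<in> I"
  shows "(r has_real_derivative - (f1 s * f2 s) / r s) (at s)"
proof -
  have "((\<lambda>s. sqrt (1 - (f1 s)\<^sup>2)) has_real_derivative - (f1 s * f2 s) / sqrt (1 - (f1 s)\<^sup>2)) (at s)"
    using deriv_less_1[OF assms] has_derivs(2)[OF assms]
    by (auto intro!: derivative_eq_intros simp: divide_simps)
  then show ?thesis by (simp add: r_def[abs_def])
qed

lemma rot_gauss_nth:
  "N p $ 1 = - (f1 (p$1) / r (p$1)) * cosh (p$2) * cosh (p$3)"
  "N p $ 2 = - (f1 (p$1) / r (p$1)) * sinh (p$2)"
  "N p $ 3 = - (f1 (p$1) / r (p$1)) * cosh (p$2) * sinh (p$3)"
  "N p $ 4 = - (1 / r (p$1))"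
  by (simp_all add: rot_gauss_def Let_def vector_4 r_def)

lemma smooth_on_comp_nth:
  fixes g :: "real \<Rightarrow> real"
  assumes "smooth_on I g"
  shows "smooth_on params (\<lambda>p. g (p$1))"
  by (rule smooth_on_compose[OF open_params assms smooth_on_nth]) (auto simp: params_def)

lemma smooth_r: "smooth_on I r"
proof (rule smooth_on_cong[OF open_I])
  show "smooth_on I (\<lambda>s. (1 - (f1 s)\<^sup>2) powr (1/2))"
    using deriv_less_1
    by (intro smooth_on_powr smooth_on_diff smooth_on_power open_I smooth_on_const smooth_derivs) auto
  show "(1 - (f1 s)\<^sup>2) powr (1/2) = r s" if "s \<in> I" for s
    using deriv_less_1[OF that] by (simp add: r_def powr_half_sqrt)
qed

lemma smooth_hyperbolic:
  "smooth_on params (\<lambda>p. sinh (p$i))" "smooth_on params (\<lambda>p. cosh (p$i))"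
  by (rule smooth_on_compose[OF open_params smooth_on_sinh smooth_on_nth]
      smooth_on_compose[OF open_params smooth_on_cosh smooth_on_nth], simp)+

lemma smooth_X: "smooth_on params X"
proof (rule smooth_on_vec[OF open_params])
  have "\<forall>i. smooth_on params (\<lambda>p. X p $ i)"
    unfolding forall_4 rot_hypersurface_nth
    by (intro conjI smooth_on_mult open_params smooth_hyperbolic smooth_on_nth
        smooth_on_comp_nth smooth_f)
  then show "smooth_on params (\<lambda>p. X p $ i)" for i ..
qed

lemma smooth_N: "smooth_on params N"
proof (rule smooth_on_vec[OF open_params])
  have "smooth_on I (\<lambda>s. f1 s / r s)" "smooth_on I (\<lambda>s. 1 / r s)"
    using r_pos by (intro smooth_on_divide open_I smooth_on_const smooth_derivs smooth_r; force)+
  then have "smooth_on params (\<lambda>p. f1 (p$1) / r (p$1))" "smooth_on params (\<lambda>p. 1 / r (p$1))"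
    using smooth_on_comp_nth by blast+
  then have "\<forall>i. smooth_on params (\<lambda>p. N p $ i)"
    unfolding forall_4 rot_gauss_nth
    by (intro conjI smooth_on_mult smooth_on_minus open_params smooth_hyperbolic)
  then show "smooth_on params (\<lambda>p. N p $ i)" for i ..
qed

lemma partial_X:
  assumes "p \<in> params"
  shows "partial 1 X p = vector [cosh (p$2) * cosh (p$3), sinh (p$2), cosh (p$2) * sinh (p$3), f1 (p$1)]"
    and "partial 2 X p = vector [p$1 * sinh (p$2) * cosh (p$3), p$1 * cosh (p$2), p$1 * sinh (p$2) * sinh (p$3), 0]"
    and "partial 3 X p = vector [p$1 * cosh (p$2) * sinh (p$3), 0, p$1 * cosh (p$2) * cosh (p$3), 0]"
proof -
  note nth = partial_nth[OF smooth_differentiable[OF smooth_X assms]]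
  have d: "((\<lambda>s::real. s) has_real_derivative 1) (at x)" "((\<lambda>s::real. 1) has_real_derivative 0) (at x)"
    "(sinh has_real_derivative cosh x) (at x)" "(cosh has_real_derivative sinh x) (at x)" for x :: real
    by (auto intro!: derivative_eq_intros)
  note c1 = partial_separated[OF open_params assms _ d(1) d(4) d(4), of "\<lambda>q. X q $ 1", OF rot_hypersurface_nth(1)]
  have "X q $ 2 = q$1 * sinh (q$2) * 1" for q
    by (simp add: rot_hypersurface_nth)
  note c2 = partial_separated[OF open_params assms _ d(1) d(3) d(2), of "\<lambda>q. X q $ 2", OF this]
  note c3 = partial_separated[OF open_params assms _ d(1) d(4) d(3), of "\<lambda>q. X q $ 3", OF rot_hypersurface_nth(3)]
  have "X q $ 4 = f (q$1) * 1 * 1" for q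
    by (simp add: rot_hypersurface_nth)
  note c4 = partial_separated[OF open_params assms _ has_derivs(1)[OF params_nth[OF assms]] d(2) d(2), of "\<lambda>q. X q $ 4", OF this]
  show "partial 1 X p = vector [cosh (p$2) * cosh (p$3), sinh (p$2), cosh (p$2) * sinh (p$3), f1 (p$1)]"
    "partial 2 X p = vector [p$1 * sinh (p$2) * cosh (p$3), p$1 * cosh (p$2), p$1 * sinh (p$2) * sinh (p$3), 0]"
    "partial 3 X p = vector [p$1 * cosh (p$2) * sinh (p$3), 0, p$1 * cosh (p$2) * cosh (p$3), 0]"
    unfolding vec_eq_iff forall_4 vector_4 nth c1 c2 c3 c4 by simp_all
qed

lemma has_derivative_gauss_profiles:
  assumes "s \<in> I"
  shows "((\<lambda>s. - (f1 s / r s)) has_real_derivative - (f2 s / r s ^ 3)) (at s)"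
    and "((\<lambda>s. - (1 / r s)) has_real_derivative - (f1 s * f2 s / r s ^ 3)) (at s)"
proof -
  have "f2 s * r s * r s + f1 s * f1 s * f2 s = f2 s"
    using r_square[OF assms] by algebra
  then show "((\<lambda>s. - (f1 s / r s)) has_real_derivative - (f2 s / r s ^ 3)) (at s)"
    using r_pos[OF assms]
    by (auto intro!: derivative_eq_intros has_derivs[OF assms] has_derivative_r[OF assms]
        simp: field_simps power3_eq_cube)
  show "((\<lambda>s. - (1 / r s)) has_real_derivative - (f1 s * f2 s / r s ^ 3)) (at s)"
    using r_pos[OF assms]
    by (auto intro!: derivative_eq_intros has_derivative_r[OF assms]
        simp: field_simps power3_eq_cube)
qed

lemma partial_N:
  assumes "p \<in> params"
  shows "partial i N p = - (\<kappa> p i *\<^sub>R partial i X p)"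
proof -
  note nth = partial_nth[OF smooth_differentiable[OF smooth_N assms]]
  have d: "((\<lambda>s::real. 1) has_real_derivative 0) (at x)"
    "(sinh has_real_derivative cosh x) (at x)" "(cosh has_real_derivative sinh x) (at x)" for x :: real
    by (auto intro!: derivative_eq_intros)
  note a = has_derivative_gauss_profiles[OF params_nth[OF assms]]
  note c1 = partial_separated[OF open_params assms _ a(1) d(3) d(3), of "\<lambda>q. N q $ 1", OF rot_gauss_nth(1)]
  have "N q $ 2 = - (f1 (q$1) / r (q$1)) * sinh (q$2) * 1" for q
    by (simp add: rot_gauss_nth)
  note c2 = partial_separated[OF open_params assms _ a(1) d(2) d(1), of "\<lambda>q. N q $ 2", OF this]
  note c3 = partial_separated[OF open_params assms _ a(1) d(3) d(2), of "\<lambda>q. N q $ 3", OF rot_gauss_nth(3)]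
  have "N q $ 4 = - (1 / r (q$1)) * 1 * 1" for q
    by (simp add: rot_gauss_nth)
  note c4 = partial_separated[OF open_params assms _ a(2) d(1) d(1), of "\<lambda>q. N q $ 4", OF this]
  have "p$1 \<noteq> 0" using nonzero[OF params_nth[OF assms]] .
  then have "\<forall>i. partial i N p = - (\<kappa> p i *\<^sub>R partial i X p)"
    unfolding forall_3 vec_eq_iff forall_4 nth c1 c2 c3 c4 partial_X[OF assms]
    by (simp add: vector_4 \<kappa>_def)
  then show ?thesis ..
qed

lemma induced_metric_X:
  assumes "p \<in> params"
  shows "induced_metric X p = diag_mat (\<lambda>i. G i p)"
proof -
  have h: "(cosh x)\<^sup>2 = 1 + (sinh x)\<^sup>2" for x :: real
    by (simp add: cosh_square_eq)
  have "\<forall>i j. lorentz (partial i X p) (partial j X p) = (if i = j then G i p else 0)"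
    unfolding forall_3 partial_X[OF assms] lorentz_vector G_def r_square[OF params_nth[OF assms]]
    using h[of "p$2"] h[of "p$3"] by (simp; intro conjI; algebra)
  then show ?thesis by (simp add: induced_metric_def diag_mat_def vec_eq_iff)
qed

lemma G_nonzero: "p \<in> params \<Longrightarrow> G i p \<noteq> 0"
  using r_pos[of "p$1"] nonzero[of "p$1"] by (auto simp: G_def params_def)

lemma shape_operator_X:
  assumes "p \<in> params"
  shows "shape_operator X N p = diag_mat (\<kappa> p)"
  using assms
  by (intro shape_operator_diag[of _ _ _ "\<lambda>i. G i p"] smooth_differentiable[OF smooth_X]
      smooth_differentiable[OF smooth_N] induced_metric_X G_nonzero partial_N)

lemma partial_G:
  assumes "p \<in> params"
  shows "partial 1 (G 1) p = 2 * f1 (p$1) * f2 (p$1)" "partial 2 (G 1) p = 0" "partial 3 (G 1) p = 0"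
    and "partial 1 (G 2) p = 2 * p$1" "partial 2 (G 2) p = 0" "partial 3 (G 2) p = 0"
    and "partial 1 (G 3) p = 2 * p$1 * (cosh (p$2))\<^sup>2"
      "partial 2 (G 3) p = (p$1)\<^sup>2 * (2 * cosh (p$2) * sinh (p$2))" "partial 3 (G 3) p = 0"
proof -
  have d: "((\<lambda>s::real. 1) has_real_derivative 0) (at x)"
    "((\<lambda>s. s\<^sup>2) has_real_derivative 2 * x) (at x)"
    "((\<lambda>s. (cosh s)\<^sup>2) has_real_derivative 2 * cosh x * sinh x) (at x)" for x :: real
    by (auto intro!: derivative_eq_intros)
  have s: "p$1 \<in> I" using params_nth[OF assms] .
  have r: "((\<lambda>s. - (r s)\<^sup>2) has_real_derivative 2 * f1 (p$1) * f2 (p$1)) (at (p$1))"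
    using r_pos[OF s] by (auto intro!: derivative_eq_intros has_derivative_r[OF s])
  have "G 1 q = - (r (q$1))\<^sup>2 * 1 * 1" for q by (simp add: G_def)
  note c1 = partial_separated[OF open_params assms _ r d(1) d(1), of "G 1", OF this]
  have "G 2 q = (q$1)\<^sup>2 * 1 * 1" for q by (simp add: G_def)
  note c2 = partial_separated[OF open_params assms _ d(2) d(1) d(1), of "G 2", OF this]
  have "G 3 q = (q$1)\<^sup>2 * (cosh (q$2))\<^sup>2 * 1" for q by (simp add: G_def)
  note c3 = partial_separated[OF open_params assms _ d(2) d(3) d(1), of "G 3", OF this]
  show "partial 1 (G 1) p = 2 * f1 (p$1) * f2 (p$1)" "partial 2 (G 1) p = 0" "partial 3 (G 1) p = 0"
    and "partial 1 (G 2) p = 2 * p$1" "partial 2 (G 2) p = 0" "partial 3 (G 2) p = 0"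
    and "partial 1 (G 3) p = 2 * p$1 * (cosh (p$2))\<^sup>2"
      "partial 2 (G 3) p = (p$1)\<^sup>2 * (2 * cosh (p$2) * sinh (p$2))" "partial 3 (G 3) p = 0"
    unfolding c1 c2 c3 by simp_all
qed

text \<open>The hypothesis on \<open>\<mu>\<close> says that \<open>B(t) C(w)\<close> is an eigenfunction of the Laplacian of
  \<open>dt\<^sup>2 + cosh\<^sup>2 t dw\<^sup>2\<close>; \<open>E\<close> is the radial component of the gradient.\<close>

lemma L_op_separated:
  fixes A A' E B B' B'' C C' C'' :: "real \<Rightarrow> real" and E' \<mu> :: real
  assumes "p \<in> params" and \<phi>: "\<And>q. q \<in> params \<Longrightarrow> \<phi> q = A (q$1) * B (q$2) * C (q$3)"
    and A: "\<And>s. s \<in> I \<Longrightarrow> (A has_real_derivative A' s) (at s)"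
    and E: "\<And>s. s \<in> I \<Longrightarrow> E s = - (A' s / (r s)\<^sup>2)"
    and E': "(E has_real_derivative E') (at (p$1))"
    and B: "\<And>t. (B has_real_derivative B' t) (at t)" "\<And>t. (B' has_real_derivative B'' t) (at t)"
    and C: "\<And>w. (C has_real_derivative C' w) (at w)" "\<And>w. (C' has_real_derivative C'' w) (at w)"
    and \<mu>: "B'' (p$2) * C (p$3) + B (p$2) * C'' (p$3) / (cosh (p$2))\<^sup>2
      + sinh (p$2) / cosh (p$2) * B' (p$2) * C (p$3) = \<mu> * (B (p$2) * C (p$3))"
  shows "L_op 2 X N \<phi> p =
    ((f1 (p$1))\<^sup>2 / ((p$1)\<^sup>2 * (r (p$1))\<^sup>2) * (E' - f1 (p$1) * f2 (p$1) * E (p$1) / (r (p$1))\<^sup>2)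
      + f1 (p$1) * f2 (p$1) / (p$1 * r (p$1) ^ 4) * (2 * E (p$1) / p$1 + \<mu> * A (p$1) / (p$1)\<^sup>2))
      * (B (p$2) * C (p$3))"
proof -
  let ?s = "p$1" and ?t = "p$2" and ?w = "p$3"
  have s: "?s \<in> I" and rs: "r ?s \<noteq> 0" and s0: "?s \<noteq> 0"
    using params_nth[OF assms(1)] r_pos nonzero by (auto simp: less_le)
  have d\<phi>: "partial 1 \<phi> q = A' (q$1) * B (q$2) * C (q$3)"
    "partial 2 \<phi> q = A (q$1) * B' (q$2) * C (q$3)"
    "partial 3 \<phi> q = A (q$1) * B (q$2) * C' (q$3)" if "q \<in> params" for q
    using partial_separated[OF open_params that \<phi> A[OF params_nth[OF that]] B(1) C(1)] by auto
  have dA: "((\<lambda>s. A s / s\<^sup>2) has_real_derivative (A' ?s * ?s\<^sup>2 - A ?s * (2 * ?s)) / (?s\<^sup>2 * ?s\<^sup>2)) (at ?s)"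
    using s0 by (auto intro!: derivative_eq_intros A[OF s])
  have H1: "partial 1 (\<lambda>q. partial 1 \<phi> q / G 1 q) p = E' * B ?t * C ?w"
    by (rule partial_separated(1)[OF open_params assms(1) _ E' B(1) C(1)])
      (simp add: d\<phi> E params_nth G_def)
  have H2: "partial 2 (\<lambda>q. partial 2 \<phi> q / G 2 q) p = A ?s / ?s\<^sup>2 * B'' ?t * C ?w"
    by (rule partial_separated(2)[OF open_params assms(1) _ dA B(2) C(1)])
      (simp add: d\<phi> G_def)
  have dB: "((\<lambda>t. B t / (cosh t)\<^sup>2) has_real_derivative
      (B' ?t * (cosh ?t)\<^sup>2 - B ?t * (2 * cosh ?t * sinh ?t)) / ((cosh ?t)\<^sup>2 * (cosh ?t)\<^sup>2)) (at ?t)"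
    by (auto intro!: derivative_eq_intros B)
  have H3: "partial 3 (\<lambda>q. partial 3 \<phi> q / G 3 q) p = A ?s / ?s\<^sup>2 * (B ?t / (cosh ?t)\<^sup>2) * C'' ?w"
    by (rule partial_separated(3)[OF open_params assms(1) _ dA dB C(2)])
      (simp add: d\<phi> G_def)
  have hess: "hessian_op X \<phi> p $ i $ i = partial i (\<lambda>q. partial i \<phi> q / G i q) p
      + (\<Sum>k\<in>UNIV. partial k (G i) p / (2 * G i p) * (partial k \<phi> p / G k p))" for i
    by (rule hessian_op_diag[OF open_params assms(1)]) (simp_all add: induced_metric_X G_nonzero)
  define ES where "ES = E ?s * B ?t * C ?w"
  have g: "partial 1 \<phi> p = - (r ?s)\<^sup>2 * ES" "G 2 p = ?s\<^sup>2" "G 3 p = ?s\<^sup>2 * (cosh ?t)\<^sup>2" "G 1 p = - (r ?s)\<^sup>2"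
    using s rs by (simp_all add: d\<phi>[OF assms(1)] E G_def ES_def)
  have h1: "hessian_op X \<phi> p $ 1 $ 1 = E' * B ?t * C ?w - f1 ?s * f2 ?s / (r ?s)\<^sup>2 * ES"
    unfolding hess sum_3 H1 partial_G[OF assms(1)] g using rs by simp
  have h2: "hessian_op X \<phi> p $ 2 $ 2 = A ?s / ?s\<^sup>2 * (B'' ?t * C ?w) + ES / ?s"
    unfolding hess sum_3 H2 partial_G[OF assms(1)] g using s0 rs by (simp add: power2_eq_square)
  have h3: "hessian_op X \<phi> p $ 3 $ 3 = A ?s / ?s\<^sup>2 * (B ?t * C'' ?w / (cosh ?t)\<^sup>2)
      + ES / ?s + A ?s / ?s\<^sup>2 * (sinh ?t / cosh ?t * B' ?t * C ?w)"
    unfolding hess sum_3 H3 partial_G[OF assms(1)] g d\<phi>(2,3)[OF assms(1)]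
    using s0 rs by (simp add: power2_eq_square mult_ac)
  have h23: "hessian_op X \<phi> p $ 2 $ 2 + hessian_op X \<phi> p $ 3 $ 3
      = 2 * ES / ?s + A ?s / ?s\<^sup>2 * (\<mu> * (B ?t * C ?w))"
    unfolding h2 h3 \<mu>[symmetric] by (simp add: algebra_simps)
  have "L_op 2 X N \<phi> p = f1 ?s / (?s * r ?s) * (f1 ?s / (?s * r ?s)) * hessian_op X \<phi> p $ 1 $ 1
      + f2 ?s / r ?s ^ 3 * (f1 ?s / (?s * r ?s)) * (hessian_op X \<phi> p $ 2 $ 2 + hessian_op X \<phi> p $ 3 $ 3)"
    unfolding L_op_def shape_operator_X[OF assms(1)] trace_newton_2_diag
    by (simp add: \<kappa>_def distrib_left)
  also have "\<dots> = ((f1 ?s)\<^sup>2 / (?s\<^sup>2 * (r ?s)\<^sup>2) * (E' - f1 ?s * f2 ?s * E ?s / (r ?s)\<^sup>2)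
      + f1 ?s * f2 ?s / (?s * r ?s ^ 4) * (2 * E ?s / ?s + \<mu> * A ?s / ?s\<^sup>2)) * (B ?t * C ?w)"
    unfolding h1 h23 ES_def
    by (simp add: divide_inverse power2_eq_square power3_eq_cube power4_eq_xxxx algebra_simps)
  finally show ?thesis .
qed

lemma homeomorphism_X:
  assumes "is_interval I"
  shows "\<exists>Y. homeomorphism params (X ` params) X Y"
proof -
  obtain \<sigma> where \<sigma>: "\<sigma> \<in> {1, -1}" "\<And>s. s \<in> I \<Longrightarrow> \<sigma> * s > 0"
    using interval_sign[OF assms zero_notin_I] by blast
  define S where "S y = \<sigma> * sqrt ((y$1)\<^sup>2 - (y$2)\<^sup>2 - (y$3)\<^sup>2)" for y :: "real^4"
  define T where "T y = arsinh (y$2 / S y)" for y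
  define W where "W y = arsinh (y$3 / (S y * cosh (T y)))" for y
  define Y :: "real^4 \<Rightarrow> real^3" where "Y y = (\<chi> i. if i = 1 then S y else if i = 2 then T y else W y)" for y
  have S: "S (X p) = p$1" if "p \<in> params" for p
  proof -
    have h: "(cosh x)\<^sup>2 = 1 + (sinh x)\<^sup>2" for x :: real
      by (simp add: cosh_square_eq)
    have "(X p $ 1)\<^sup>2 - (X p $ 2)\<^sup>2 - (X p $ 3)\<^sup>2 = (p$1)\<^sup>2"
      unfolding rot_hypersurface_nth using h[of "p$2"] h[of "p$3"] by algebra
    moreover have "\<sigma> * \<bar>p$1\<bar> = p$1"
      using \<sigma>(1) \<sigma>(2)[OF params_nth[OF that]] by auto
    ultimately show ?thesis by (simp add: S_def)
  qed
  have T: "T (X p) = p$2" if "p \<in> params" for p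
    using nonzero[OF params_nth[OF that]] by (simp add: T_def S[OF that] rot_hypersurface_nth arsinh_sinh_real)
  have W: "W (X p) = p$3" if "p \<in> params" for p
    using nonzero[OF params_nth[OF that]]
    by (simp add: W_def S[OF that] T[OF that] rot_hypersurface_nth arsinh_sinh_real)
  have Y: "Y (X p) = p" if "p \<in> params" for p
    using S[OF that] T[OF that] W[OF that] by (simp add: Y_def vec_eq_iff forall_3)
  have S0: "\<forall>y\<in>X ` params. S y \<noteq> 0"
    using S nonzero params_nth by auto
  have cS: "continuous_on (X ` params) S"
    unfolding S_def by (intro continuous_intros)
  have cT: "continuous_on (X ` params) T"
    unfolding T_def
    by (intro continuous_on_compose2[OF continuous_on_arsinh[of UNIV]] continuous_intros cS S0) simp
  have cW: "continuous_on (X ` params) W"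
    unfolding W_def using S0
    by (intro continuous_on_compose2[OF continuous_on_arsinh[of UNIV]] continuous_intros cS cT) auto
  have "continuous_on (X ` params) Y"
    unfolding Y_def
  proof (rule continuous_on_vec_lambda)
    show "continuous_on (X ` params) (\<lambda>y. if i = 1 then S y else if i = 2 then T y else W y)" for i :: 3
      by (cases "i = 1"; cases "i = 2") (simp_all add: cS cT cW)
  qed
  moreover have "continuous_on params X"
    using smooth_X unfolding smooth_on_def by (metis Ck_on.simps(1))
  ultimately have "homeomorphism params (X ` params) X Y"
    using Y by (force simp: homeomorphism_def)
  then show ?thesis by blast
qed

lemma oriented_hypersurface_X:
  assumes "is_interval I"
  shows "oriented_hypersurface params X N"
  unfolding oriented_hypersurface_def
proof (intro conjI ballI allI bexI[of _ 1])
  fix p assume p: "p \<in> params"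
  show "det (induced_metric X p) \<noteq> 0"
    using G_nonzero[OF p] by (simp add: induced_metric_X[OF p] det_diag_mat)
  have h: "(cosh x)\<^sup>2 = 1 + (sinh x)\<^sup>2" for x :: real
    by (simp add: cosh_square_eq)
  define u where "u = - (1 / r (p$1))"
  have N: "N p = vector [u * f1 (p$1) * cosh (p$2) * cosh (p$3), u * f1 (p$1) * sinh (p$2),
      u * f1 (p$1) * cosh (p$2) * sinh (p$3), u]"
    unfolding vec_eq_iff forall_4 vector_4 rot_gauss_nth u_def by simp
  have u: "u\<^sup>2 * (1 - (f1 (p$1))\<^sup>2) = 1"
    using r_pos[OF params_nth[OF p]] by (simp add: u_def power_divide flip: r_square[OF params_nth[OF p]])
  show "lorentz (N p) (N p) = 1"
    unfolding N lorentz_vector using h[of "p$2"] h[of "p$3"] u by algebra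
  have "\<forall>i. lorentz (N p) (partial i X p) = 0"
    unfolding forall_3 partial_X[OF p] N lorentz_vector
  proof (intro conjI)
    show "- (u * f1 (p$1) * cosh (p$2) * cosh (p$3) * (cosh (p$2) * cosh (p$3)))
        + u * f1 (p$1) * sinh (p$2) * sinh (p$2)
        + u * f1 (p$1) * cosh (p$2) * sinh (p$3) * (cosh (p$2) * sinh (p$3)) + u * f1 (p$1) = 0"
      using h[of "p$2"] h[of "p$3"] by algebra
    show "- (u * f1 (p$1) * cosh (p$2) * cosh (p$3) * (p$1 * sinh (p$2) * cosh (p$3)))
        + u * f1 (p$1) * sinh (p$2) * (p$1 * cosh (p$2))
        + u * f1 (p$1) * cosh (p$2) * sinh (p$3) * (p$1 * sinh (p$2) * sinh (p$3)) + u * 0 = 0"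
      using h[of "p$3"] by algebra
  qed simp
  then show "lorentz (N p) (partial i X p) = 0" for i ..
qed (use open_params smooth_X smooth_N homeomorphism_X[OF assms] in auto)

definition \<mm> :: "real \<Rightarrow> real" where
  "\<mm> s = (2 * f2 s * (f1 s * r s ^ 4 - s * (2 * (f1 s)\<^sup>2 + 1) * f2 s) - s * (r s)\<^sup>2 * f1 s * f3 s)
    / (s ^ 3 * r s ^ 8)"

definition \<nn> :: "real \<Rightarrow> real" where
  "\<nn> s = - ((f2 s * (- (2 * f1 s * (r s)\<^sup>2) + s * (3 * (f1 s)\<^sup>2 + 2) * f2 s) + s * (r s)\<^sup>2 * f1 s * f3 s)
    / (s ^ 3 * r s ^ 7))"

lemma smooth_coefficients: "smooth_on I \<mm>" "smooth_on I \<nn>"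
  unfolding \<mm>_def \<nn>_def using r_pos nonzero
  by (intro smooth_on_divide smooth_on_minus smooth_on_diff smooth_on_add smooth_on_mult smooth_on_power
      open_I smooth_on_const smooth_on_ident smooth_derivs smooth_r; force)+

lemma has_derivative_grad_profiles:
  assumes "s \<in> I"
  shows "((\<lambda>s. f2 s / r s ^ 5) has_real_derivative
      f3 s / r s ^ 5 + 5 * f1 s * (f2 s)\<^sup>2 / r s ^ 7) (at s)"
    and "((\<lambda>s. f1 s * f2 s / r s ^ 5) has_real_derivative
      (f2 s)\<^sup>2 / r s ^ 5 + f1 s * f3 s / r s ^ 5 + 5 * (f1 s)\<^sup>2 * (f2 s)\<^sup>2 / r s ^ 7) (at s)"
proof -
  have r0: "r s \<noteq> 0"
    using r_pos[OF assms] by simp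
  have "((\<lambda>s. r s ^ 5) has_real_derivative 5 * r s ^ 4 * (- (f1 s * f2 s) / r s)) (at s)"
    using DERIV_power[OF has_derivative_r[OF assms], of 5] by (simp add: mult_ac)
  from DERIV_divide[OF has_derivs(3)[OF assms] this]
    DERIV_divide[OF DERIV_mult[OF has_derivs(2,3)[OF assms]] this] r0
  have 1: "((\<lambda>s. f2 s / r s ^ 5) has_real_derivative
      (f3 s * r s ^ 5 - f2 s * (5 * r s ^ 4 * (- (f1 s * f2 s) / r s))) / (r s ^ 5 * r s ^ 5)) (at s)"
    and 2: "((\<lambda>s. f1 s * f2 s / r s ^ 5) has_real_derivative
      ((f2 s * f2 s + f3 s * f1 s) * r s ^ 5 - f1 s * f2 s * (5 * r s ^ 4 * (- (f1 s * f2 s) / r s)))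
        / (r s ^ 5 * r s ^ 5)) (at s)"
    by simp_all
  have "(c * \<rho> ^ 5 - b * (5 * \<rho> ^ 4 * (- d / \<rho>))) / (\<rho> ^ 5 * \<rho> ^ 5) = c / \<rho> ^ 5 + 5 * b * d / \<rho> ^ 7"
    if "\<rho> \<noteq> 0" for b c d \<rho> :: real
    using that by (simp add: field_simps) (simp add: algebra_simps power_numeral_reduce)
  note eq = this[OF r0]
  show "((\<lambda>s. f2 s / r s ^ 5) has_real_derivative
      f3 s / r s ^ 5 + 5 * f1 s * (f2 s)\<^sup>2 / r s ^ 7) (at s)"
    using 1 unfolding eq by (simp add: power2_eq_square mult_ac)
  show "((\<lambda>s. f1 s * f2 s / r s ^ 5) has_real_derivative
      (f2 s)\<^sup>2 / r s ^ 5 + f1 s * f3 s / r s ^ 5 + 5 * (f1 s)\<^sup>2 * (f2 s)\<^sup>2 / r s ^ 7) (at s)"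
    using 2 unfolding eq by (simp add: power2_eq_square mult_ac add_divide_distrib)
qed

lemma L_op_gauss_first:
  assumes "p \<in> params" and "\<And>q. q \<in> params \<Longrightarrow> \<phi> q = - (f1 (q$1) / r (q$1)) * B (q$2) * C (q$3)"
    and "\<And>t. (B has_real_derivative B' t) (at t)" "\<And>t. (B' has_real_derivative B'' t) (at t)"
    and "\<And>w. (C has_real_derivative C' w) (at w)" "\<And>w. (C' has_real_derivative C'' w) (at w)"
    and "B'' (p$2) * C (p$3) + B (p$2) * C'' (p$3) / (cosh (p$2))\<^sup>2
      + sinh (p$2) / cosh (p$2) * B' (p$2) * C (p$3) = 2 * (B (p$2) * C (p$3))"
  shows "L_op 2 X N \<phi> p = \<mm> (p$1) * \<phi> p"
proof -
  have s: "p$1 \<in> I" and s0: "p$1 \<noteq> 0" and r0: "r (p$1) \<noteq> 0"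
    using params_nth[OF assms(1)] r_pos nonzero by (auto simp: less_le)
  have E: "f2 s / r s ^ 5 = - (- (f2 s / r s ^ 3) / (r s)\<^sup>2)" for s
    by (simp flip: power_add)
  show ?thesis
    by (rule trans[OF L_op_separated[OF assms(1,2) has_derivative_gauss_profiles(1) E
            has_derivative_grad_profiles(1)[OF s] assms(3-7)]])
      (assumption | simp only: L2_profile_first[OF s0 r0] assms(2)[OF assms(1)] \<mm>_def | simp only: mult.assoc)+
qed

lemma L_op_gauss_last:
  assumes "p \<in> params"
  shows "L_op 2 X N (\<lambda>q. N q $ 4) p = \<mm> (p$1) * N p $ 4 + \<nn> (p$1)"
proof -
  have s: "p$1 \<in> I" and s0: "p$1 \<noteq> 0" and r0: "r (p$1) \<noteq> 0"
    using params_nth[OF assms(1)] r_pos nonzero by (auto simp: less_le)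
  have E: "f1 s * f2 s / r s ^ 5 = - (- (f1 s * f2 s / r s ^ 3) / (r s)\<^sup>2)" for s
    by (simp flip: power_add)
  have "L_op 2 X N (\<lambda>q. N q $ 4) p =
    ((f1 (p$1))\<^sup>2 / ((p$1)\<^sup>2 * (r (p$1))\<^sup>2)
      * ((f2 (p$1))\<^sup>2 / r (p$1) ^ 5 + f1 (p$1) * f3 (p$1) / r (p$1) ^ 5 + 5 * (f1 (p$1))\<^sup>2 * (f2 (p$1))\<^sup>2 / r (p$1) ^ 7
        - f1 (p$1) * f2 (p$1) * (f1 (p$1) * f2 (p$1) / r (p$1) ^ 5) / (r (p$1))\<^sup>2)
      + f1 (p$1) * f2 (p$1) / (p$1 * r (p$1) ^ 4)
        * (2 * (f1 (p$1) * f2 (p$1) / r (p$1) ^ 5) / p$1 + 0 * - (1 / r (p$1)) / (p$1)\<^sup>2)) * (1 * 1)"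
    by (rule L_op_separated[OF assms _ has_derivative_gauss_profiles(2) E
          has_derivative_grad_profiles(2)[OF s], where B' = "\<lambda>t. 0" and B'' = "\<lambda>t. 0"
          and C' = "\<lambda>w. 0" and C'' = "\<lambda>w. 0"])
      (simp_all add: rot_gauss_nth)
  also have "\<dots> = \<mm> (p$1) * N p $ 4 + \<nn> (p$1)"
    using L2_profile_last[OF s0 r0 r_square[OF s], of "f2 (p$1)" "f3 (p$1)"]
    by (simp add: \<mm>_def \<nn>_def rot_gauss_nth)
  finally show ?thesis .
qed

lemma L_vec_gauss:
  assumes "p \<in> params"
  shows "L_vec 2 X N N p = \<mm> (p$1) *\<^sub>R N p + \<nn> (p$1) *\<^sub>R axis 4 1"
proof -
  have d: "((\<lambda>t::real. 1) has_real_derivative 0) (at x)" "((\<lambda>t::real. 0) has_real_derivative 0) (at x)"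
    "(sinh has_real_derivative cosh x) (at x)" "(cosh has_real_derivative sinh x) (at x)" for x :: real
    by (auto intro!: derivative_eq_intros)
  have h: "cosh x + 1 / cosh x + sinh x / cosh x * sinh x = 2 * cosh x" for x :: real
  proof -
    have "cosh x + 1 / cosh x + sinh x / cosh x * sinh x = (cosh x * cosh x + (1 + sinh x * sinh x)) / cosh x"
      by (simp add: add_divide_distrib)
    also have "1 + sinh x * sinh x = cosh x * cosh x"
      using cosh_square_eq[of x] by (simp add: power2_eq_square)
    finally show ?thesis by simp
  qed
  have h': "cosh x * c + cosh x * c / (cosh x)\<^sup>2 + sinh x / cosh x * sinh x * c = 2 * (cosh x * c)" for x c :: real
  proof -
    have "cosh x * c + cosh x * c / (cosh x)\<^sup>2 + sinh x / cosh x * sinh x * c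
        = (cosh x + 1 / cosh x + sinh x / cosh x * sinh x) * c"
      by (simp add: power2_eq_square distrib_right)
    then show ?thesis unfolding h by simp
  qed
  have "L_op 2 X N (\<lambda>q. N q $ 1) p = \<mm> (p$1) * N p $ 1"
    by (rule L_op_gauss_first[OF assms rot_gauss_nth(1) d(4) d(3) d(4) d(3) h'])
  moreover have "L_op 2 X N (\<lambda>q. N q $ 2) p = \<mm> (p$1) * N p $ 2"
    by (rule L_op_gauss_first[OF assms _ d(3) d(4) d(1) d(2)]) (simp_all add: rot_gauss_nth)
  moreover have "L_op 2 X N (\<lambda>q. N q $ 3) p = \<mm> (p$1) * N p $ 3"
    by (rule L_op_gauss_first[OF assms rot_gauss_nth(3) d(4) d(3) d(3) d(4) h'])
  ultimately show ?thesis
    using L_op_gauss_last[OF assms]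
    by (simp add: L_vec_def vec_eq_iff forall_4 axis_def)
qed

end

theorem theorem11:
  fixes I :: "real set" and f f' f'' f''' \<mm> \<nn> :: "real \<Rightarrow> real" and C\<^sub>4 :: real
    and U :: "(real^3) set" and \<Gamma> N :: "real^3 \<Rightarrow> real^4"
  assumes "open I" and "is_interval I" and "0 \<notin> I"
    and "smooth_on I f"
    and "f' = deriv f" and "f'' = deriv f'" and "f''' = deriv f''"
    and "\<And>s. s \<in> I \<Longrightarrow> (f' s)\<^sup>2 < 1"
    and "\<And>s. s \<in> I \<Longrightarrow> f'' s \<noteq> 0"
    and "C\<^sub>4 \<noteq> 0"
    and "\<And>s. s \<in> I \<Longrightarrow> \<mm> s =
      (2 * f'' s * (f' s * ((f' s)\<^sup>2 - 1)\<^sup>2 - s * (2 * (f' s)\<^sup>2 + 1) * f'' s)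
         + s * ((f' s)\<^sup>2 - 1) * f' s * f''' s) / (s ^ 3 * ((f' s)\<^sup>2 - 1) ^ 4)"
    and "\<And>s. s \<in> I \<Longrightarrow> \<nn> s =
      - ((f'' s * (2 * f' s * ((f' s)\<^sup>2 - 1) + s * (3 * (f' s)\<^sup>2 + 2) * f'' s)
            - s * ((f' s)\<^sup>2 - 1) * f' s * f''' s)
         / (C\<^sub>4 * s ^ 3 * (1 - (f' s)\<^sup>2) powr (7 / 2)))"
    and "\<exists>s\<in>I. \<mm> s \<noteq> 0" and "\<exists>s\<in>I. \<nn> s \<noteq> 0"
    and "U = {p. p$1 \<in> I}" and "\<Gamma> = rot_hypersurface f" and "N = rot_gauss f"
  shows "oriented_hypersurface U \<Gamma> N \<and>
    generalized_1_type_Gauss_map 2 U \<Gamma> N \<and>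
    (\<forall>p\<in>U. L_vec 2 \<Gamma> N N p = \<mm> (p$1) *\<^sub>R N p + \<nn> (p$1) *\<^sub>R vector [0, 0, 0, C\<^sub>4])"
proof -
  interpret rot_profile I f
    using assms(1,3,4,5,8) by unfold_locales auto
  have U: "U = params"
    using assms(15) by (simp add: params_def)
  have m: "\<mm> s = rot_profile.\<mm> f s" if "s \<in> I" for s
  proof -
    have D: "(f' s)\<^sup>2 - 1 = - (r s)\<^sup>2"
      using r_square[OF that] assms(5) by simp
    have "(- (r s)\<^sup>2)\<^sup>2 = r s ^ 4" "(- (r s)\<^sup>2) ^ 4 = r s ^ 8"
      by (simp_all flip: power_mult)
    then show ?thesis
      unfolding assms(11)[OF that] D \<mm>_def by (simp add: assms(5-7))
  qed
  have n: "\<nn> s = rot_profile.\<nn> f s / C\<^sub>4" if "s \<in> I" for s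
  proof -
    have D: "(f' s)\<^sup>2 - 1 = - (r s)\<^sup>2" "1 - (f' s)\<^sup>2 = (r s)\<^sup>2"
      using r_square[OF that] assms(5) by simp_all
    have "((r s)\<^sup>2) powr (7 / 2) = r s ^ 7"
      using r_pos[OF that] by (simp add: powr_powr flip: powr_numeral)
    then show ?thesis
      unfolding assms(12)[OF that] D \<nn>_def using assms(10) by (simp add: assms(5-7) mult_ac)
  qed
  have C: "(vector [0, 0, 0, C\<^sub>4] :: real^4) = C\<^sub>4 *\<^sub>R axis 4 1"
    unfolding vec_eq_iff forall_4 vector_4 by (simp add: axis_def)
  have L: "L_vec 2 \<Gamma> N N p = \<mm> (p$1) *\<^sub>R N p + \<nn> (p$1) *\<^sub>R vector [0, 0, 0, C\<^sub>4]" if "p \<in> U" for p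
  proof -
    have p: "p \<in> params" using that U by simp
    show ?thesis
      using assms(10) by (simp add: assms(16,17) L_vec_gauss[OF p] m[OF params_nth[OF p]] n[OF params_nth[OF p]] C)
  qed
  have "smooth_on I (\<lambda>s. rot_profile.\<nn> f s / C\<^sub>4)"
    using assms(10) by (intro smooth_on_divide open_I smooth_coefficients smooth_on_const) auto
  then have "smooth_on I \<nn>"
    by (rule smooth_on_cong[OF open_I]) (simp add: n)
  moreover have "smooth_on I \<mm>"
    by (rule smooth_on_cong[OF open_I smooth_coefficients(1)]) (simp add: m)
  ultimately have smooth: "smooth_on U (\<lambda>p. \<mm> (p$1))" "smooth_on U (\<lambda>p. \<nn> (p$1))"
    unfolding U by (simp_all add: smooth_on_comp_nth)
  have ex: "\<exists>p\<in>U. g (p$1) \<noteq> 0" if g: "\<exists>s\<in>I. g s \<noteq> 0" for g :: "real \<Rightarrow> real"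
  proof -
    obtain s where "s \<in> I" "g s \<noteq> 0" using g by blast
    then show ?thesis
      unfolding assms(15) by (intro bexI[of _ "\<chi> i. s"]) simp_all
  qed
  have "(vector [0, 0, 0, C\<^sub>4] :: real^4) \<noteq> 0"
    using assms(10) by (simp add: C axis_eq_0_iff)
  with smooth ex[OF assms(13)] ex[OF assms(14)] L have "generalized_1_type_Gauss_map 2 U \<Gamma> N"
    unfolding generalized_1_type_Gauss_map_def
    by (intro exI[of _ "\<lambda>p. \<mm> (p$1)"] exI[of _ "\<lambda>p. \<nn> (p$1)"]
        exI[of _ "vector [0, 0, 0, C\<^sub>4]"] conjI ballI)
  moreover have "oriented_hypersurface U \<Gamma> N"
    unfolding U assms(16,17) by (rule oriented_hypersurface_X[OF assms(2)])
  ultimately show ?thesis using L by blast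
qed

end
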